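(* Consider the $(n+1)$-bus power distribution system described in the context (one slack bus, and $n$ PQ buses indexed by $\mathcal{G}\cup\mathcal{L}=\{1,\dots,n\}$). Let $S\in\mathbb{C}^n$ be a power injection lying on the power flow solvability boundary, and let $(V,I)\in\mathbb{C}^n\times\mathbb{C}^n$ be a power flow solution for $S$. Then there exists $h\in\mathcal{G}\cup\mathcal{L}$ such that $$|V_h|\le\sum_{i=1}^n |Z_{hi}I_i| .$$
   Context: System model. The system has $n+1$ buses: one slack bus with fixed voltage phasor $V_{\mathcal{S}}=1\angle 0^\circ=1$, and $n$ further buses, indexed by $1,\dots,n$, which are distributed generator (DG) buses $\mathcal{G}=\{1,\dots,g\}$ and load buses $\mathcal{L}=\{g+1,\dots,n\}$. All buses in $\mathcal{G}\cup\mathcal{L}$ are PQ (constant-power) buses, i.e. their complex power injections $S_i=P_i+jQ_i$ are given ($j$ is the imaginary unit). The slack current $I_{\mathcal{S}}\in\mathbb{C}$, the vector of bus currents $I\in\mathbb{C}^n$ and the vector of bus voltages $V\in\mathbb{C}^n$ are related through the block admittance matrix by $$\begin{bmatrix} I_{\mathcal{S}}\\ I\end{bmatrix}=\begin{bmatrix} Y_{\mathcal{SS}} & Y_{\mathcal{SL}}\\ Y_{\mathcal{LS}} & Y_{\mathcal{LL}}\end{bmatrix}\begin{bmatrix} V_{\mathcal{S}}\\ V\end{bmatrix},$$ where $Y_{\mathcal{LL}}\in\mathbb{C}^{n\times n}$ is invertible. Put $E=-Y_{\mathcal{LL}}^{-1}Y_{\mathcal{LS}}V_{\mathcal{S}}\in\mathbb{C}^n$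 and $Z=-Y_{\mathcal{LL}}^{-1}\in\mathbb{C}^{n\times n}$, so that $V=E-ZI$. Power flow equations. Given $S\in\mathbb{C}^n$, a power flow solution for $S$ is a pair $(V,I)$ with $V=E-ZI$ and $S=\mathrm{diag}(I^* )V$, i.e. $S_h=I_h^*\bigl(E_h-\sum_{i=1}^n Z_{hi}I_i\bigr)$ for all $h=1,\dots,n$, where $^*$ denotes entrywise complex conjugation. Solvability boundary. The power flow solvability boundary is the topological boundary in $\mathbb{C}^n\cong\mathbb{R}^{2n}$ of the set of $S\in\mathbb{C}^n$ for which a power flow solution exists. *)

theory Defs
  imports "HOL-Analysis.Analysis"
begin

text \<open>
  The buses are indexed by \<open>'n option\<close>: \<open>None\<close> is the slack bus and \<open>Some h\<close>, with \<open>h\<close> ranging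
  over the finite type \<open>'n\<close> (so \<open>n = CARD('n)\<close>), are the PQ buses. The admittance matrix \<open>Y\<close> is
  the full \<open>(n+1) \<times> (n+1)\<close> matrix; its blocks are extracted below.
\<close>

definition Y_LL :: "complex ^ ('n option) ^ ('n option) \<Rightarrow> complex ^ 'n ^ 'n" where
  "Y_LL Y = (\<chi> h i. Y $ Some h $ Some i)"

definition Y_LS :: "complex ^ ('n option) ^ ('n option) \<Rightarrow> complex ^ 'n" where
  "Y_LS Y = (\<chi> h. Y $ Some h $ None)"

definition V_slack :: complex where
  "V_slack = 1"

definition E_vec :: "complex ^ ('n option) ^ ('n option) \<Rightarrow> complex ^ 'n" where
  "E_vec Y = - (matrix_inv (Y_LL Y) *v (V_slack *s Y_LS Y))"

definition Z_mat :: "complex ^ ('n option) ^ ('n option) \<Rightarrow> complex ^ 'n ^ 'n" where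
  "Z_mat Y = - matrix_inv (Y_LL Y)"

definition power_flow_solution ::
  "complex ^ ('n option) ^ ('n option) \<Rightarrow> complex ^ 'n \<Rightarrow> complex ^ 'n \<Rightarrow> complex ^ 'n \<Rightarrow> bool"
  where
  "power_flow_solution Y S V I \<longleftrightarrow>
     V = E_vec Y - Z_mat Y *v I \<and> (\<forall>h. S $ h = cnj (I $ h) * V $ h)"

definition solvability_boundary ::
  "complex ^ ('n option) ^ ('n option) \<Rightarrow> (complex ^ 'n) set" where
  "solvability_boundary Y = frontier {S. \<exists>V I. power_flow_solution Y S V I}"

definition with_slack :: "'a \<Rightarrow> 'a ^ 'n \<Rightarrow> 'a ^ ('n option)" where
  "with_slack a x = (\<chi> b. case b of None \<Rightarrow> a | Some h \<Rightarrow> x $ h)"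

text \<open>
  The relation \<open>V = E - Z I\<close> is the full network equation with the slack current eliminated
  (the slack current is determined by the slack row and is otherwise unconstrained).
\<close>

lemma network_equation_iff:
  fixes Y :: "complex ^ ('n::finite option) ^ ('n option)" and V I :: "complex ^ 'n"
  assumes "invertible (Y_LL Y)"
  shows "(\<exists>I_S. with_slack I_S I = Y *v with_slack V_slack V) \<longleftrightarrow> V = E_vec Y - Z_mat Y *v I"
proof -
  let ?W = "matrix_inv (Y_LL Y)"
  have inv: "?W ** Y_LL Y = mat 1" "Y_LL Y ** ?W = mat 1"
    using assms unfolding invertible_def matrix_inv_def
    by (metis (mono_tags, lifting) someI_ex)+
  have sum_opt: "(\<Sum>b\<in>UNIV. f b) = f None + (\<Sum>i\<in>UNIV. f (Some i))" for f :: "'n option \<Rightarrow> complex"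
    by (simp add: UNIV_option_conv sum.reindex)
  have "(\<exists>I_S. with_slack I_S I = Y *v with_slack V_slack V)
      \<longleftrightarrow> I = V_slack *s Y_LS Y + Y_LL Y *v V"
    by (simp add: vec_eq_iff with_slack_def matrix_vector_mult_def sum_opt Y_LS_def Y_LL_def
        split_option_all mult.commute)
  also have "\<dots> \<longleftrightarrow> Y_LL Y *v V = I - V_slack *s Y_LS Y"
    by (auto simp: algebra_simps)
  also have "\<dots> \<longleftrightarrow> V = ?W *v (I - V_slack *s Y_LS Y)"
    by (metis inv matrix_vector_mul_assoc matrix_vector_mul_lid)
  also have "\<dots> \<longleftrightarrow> V = E_vec Y - Z_mat Y *v I"
  proof -
    have "(- ?W) *v I = - (?W *v I)"
      by (simp add: vec_eq_iff matrix_vector_mult_def sum_negf)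
    then show ?thesis
      by (simp add: E_vec_def Z_mat_def matrix_vector_mult_diff_distrib)
  qed
  finally show ?thesis .
qed

end

theory Submission
  imports Defs
begin

text \<open>
  Writing \<open>F(I)\<^sub>h = cnj I\<^sub>h (E - Z I)\<^sub>h\<close>, the solvable injections are the range of \<open>F\<close>. If
  \<open>|V\<^sub>h| > \<Sum>\<^sub>i |Z\<^sub>h\<^sub>i I\<^sub>i|\<close> held at every bus, the real derivative of \<open>F\<close> at \<open>I\<close>, rescaled by
  \<open>u\<^sub>i = I\<^sub>i w\<^sub>i\<close>, would be strictly diagonally dominant and hence invertible, so \<open>F\<close> would be open
  at \<open>I\<close> and \<open>S = F(I)\<close> would be interior to the range.
\<close>

text \<open>A maximum principle: compare both sides of \<open>kernel\<close> in the row where the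
  ratio of \<open>norm (u $ i)\<close> to \<open>norm (I $ i)\<close> is largest. Unless that ratio
  is 0, the row contradicts \<open>dominant\<close>. The two hypotheses give no bound on
  \<open>u\<close> itself, hence the rescaling by \<open>I\<close>.\<close>

lemma power_flow_derivative_injective:
  fixes V I u :: "complex ^ 'n::finite" and Z :: "complex ^ 'n ^ 'n"
  assumes dominant: "\<And>h. (\<Sum>i\<in>UNIV. norm (Z $ h $ i * I $ i)) < norm (V $ h)"
    and kernel: "\<And>h. cnj (u $ h) * V $ h = cnj (I $ h) * (\<Sum>i\<in>UNIV. Z $ h $ i * u $ i)"
  shows "u = 0"
proof -
  have V_nonzero: "V $ h \<noteq> 0" for h
  proof -
    have "0 \<le> (\<Sum>i\<in>UNIV. norm (Z $ h $ i * I $ i))"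
      by (intro sum_nonneg) auto
    then show ?thesis
      using dominant[of h] by auto
  qed
  \<comment> \<open>Buses without current are settled separately, since the rescaling divides by
    \<open>I $ h\<close>. Division by 0 yields \<open>w h = 0\<close> there, which is consistent
    with \<open>u $ h = 0\<close>.\<close>
  have u_zero: "u $ h = 0" if "I $ h = 0" for h
    using kernel[of h] V_nonzero[of h] that by simp
  define w where "w i = norm (u $ i) / norm (I $ i)" for i
  have u_eq: "norm (u $ i) = norm (I $ i) * w i" for i
    using u_zero[of i] by (cases "I $ i = 0") (auto simp: w_def)
  define m where "m = Max (range w)"
  have w_le: "w i \<le> m" for i
    by (simp add: m_def)
  have "m \<in> range w"
    unfolding m_def by (intro Max_in) auto
  then obtain k where k: "m = w k"
    by auto
  have "m = 0"
  proof (rule ccontr)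
    assume "m \<noteq> 0"
    then have Ik: "I $ k \<noteq> 0"
      using k by (auto simp: w_def)
    have m_pos: "0 < m"
      using \<open>m \<noteq> 0\<close> k by (simp add: w_def order.not_eq_order_implies_strict)
    \<comment> \<open>Row \<open>k\<close> of \<open>kernel\<close> in absolute value. Both sides
      carry the factor \<open>norm (I $ k)\<close>, which cancels.\<close>
    have "norm (I $ k) * (m * norm (V $ k)) = norm (cnj (u $ k) * V $ k)"
      by (simp add: norm_mult u_eq k)
    also have "\<dots> = norm (I $ k) * norm (\<Sum>i\<in>UNIV. Z $ k $ i * u $ i)"
      by (simp add: kernel norm_mult)
    finally have "m * norm (V $ k) = norm (\<Sum>i\<in>UNIV. Z $ k $ i * u $ i)"
      using Ik by simp
    also have "\<dots> \<le> (\<Sum>i\<in>UNIV. m * norm (Z $ k $ i * I $ i))"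
    proof (rule sum_norm_le)
      fix i
      have "norm (Z $ k $ i * u $ i) = w i * norm (Z $ k $ i * I $ i)"
        by (simp add: norm_mult u_eq)
      also have "\<dots> \<le> m * norm (Z $ k $ i * I $ i)"
        by (intro mult_right_mono w_le) simp
      finally show "norm (Z $ k $ i * u $ i) \<le> m * norm (Z $ k $ i * I $ i)" .
    qed
    also have "\<dots> = m * (\<Sum>i\<in>UNIV. norm (Z $ k $ i * I $ i))"
      by (simp add: sum_distrib_left)
    also have "\<dots> < m * norm (V $ k)"
      using dominant[of k] m_pos by simp
    finally show False
      by simp
  qed
  then have "norm (u $ i) \<le> 0" for i
    using w_le[of i] by (simp add: u_eq mult_nonneg_nonpos)
  then show ?thesis
    by (simp add: vec_eq_iff)
qed

text \<open>The derivative at \<open>I\<close> is injective, hence bijective in finite dimension, so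
  \<open>F\<close> maps neighbourhoods of \<open>I\<close> onto neighbourhoods of
  \<open>F I\<close>.\<close>

lemma power_flow_interior:
  fixes E I :: "complex ^ 'n::finite" and Z :: "complex ^ 'n ^ 'n"
  defines "F \<equiv> \<lambda>I. \<chi> h. cnj (I $ h) * (E - Z *v I) $ h"
  assumes dominant: "\<And>h. (\<Sum>i\<in>UNIV. norm (Z $ h $ i * I $ i)) < norm ((E - Z *v I) $ h)"
  shows "F I \<in> interior (range F)"
proof -
  \<comment> \<open>The product rule applied to \<open>F\<close>. Conjugation makes \<open>D\<close>
    linear over the reals only.\<close>
  define D where "D u = (\<chi> h. cnj (u $ h) * (E - Z *v I) $ h
      - cnj (I $ h) * (\<Sum>i\<in>UNIV. Z $ h $ i * u $ i))" for u
  have "((\<lambda>J. F J $ h) has_derivative (\<lambda>u. D u $ h)) (at I)" for h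
  proof -
    have "((\<lambda>J. cnj (J $ h) * (E $ h - (\<Sum>i\<in>UNIV. Z $ h $ i * J $ i))) has_derivative
        (\<lambda>u. cnj (I $ h) * (0 - (\<Sum>i\<in>UNIV. Z $ h $ i * u $ i))
          + cnj (u $ h) * (E $ h - (\<Sum>i\<in>UNIV. Z $ h $ i * I $ i)))) (at I)"
      by (intro has_derivative_mult has_derivative_diff has_derivative_const has_derivative_sum
          has_derivative_cnj has_derivative_mult_right bounded_linear_imp_has_derivative
          bounded_linear_vec_nth)
    then show ?thesis
      by (simp add: F_def D_def matrix_vector_mult_def algebra_simps)
  qed
  then have deriv: "(F has_derivative D) (at I)"
    \<comment> \<open>The real basis vectors are \<open>axis h b\<close> with \<open>b\<close> in
      the basis of the complex numbers, so each coordinate is an inner product of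
      \<open>F J $ h\<close> with \<open>b\<close>.\<close>
    unfolding has_derivative_componentwise_within[of F]
    by (auto simp: Basis_vec_def inner_axis intro!: has_derivative_inner_left)
  then have lin: "linear D"
    by (rule has_derivative_linear)
  have "inj D"
    unfolding linear_injective_0[OF lin]
  proof (intro allI impI)
    fix u assume "D u = 0"
    then have "D u $ h = 0" for h
      by simp
    then have "cnj (u $ h) * (E - Z *v I) $ h = cnj (I $ h) * (\<Sum>i\<in>UNIV. Z $ h $ i * u $ i)" for h
      by (simp only: D_def vec_lambda_beta right_minus_eq)
    with dominant show "u = 0"
      by (rule power_flow_derivative_injective)
  qed
  then obtain D' where D': "linear D'" "D \<circ> D' = id"
    using linear_injective_isomorphism[OF lin] by (metis comp_apply eq_id_iff)
  have "continuous_on UNIV F"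
    unfolding F_def matrix_vector_mult_def by (intro continuous_intros)
  \<comment> \<open>This open mapping theorem asks for continuity, differentiability at the single
    point \<open>I\<close>, and a bounded right inverse of the derivative there.\<close>
  from sussmann_open_mapping[OF open_UNIV this UNIV_I deriv
      linear_conv_bounded_linear[THEN iffD1, OF D'(1)] D'(2), of UNIV]
  show ?thesis
    by simp
qed

theorem theorem2:
  fixes Y :: "complex ^ ('n::finite option) ^ ('n option)"
    and G L :: "'n set"
    and S V I :: "complex ^ 'n"
  assumes "G \<union> L = UNIV" and "G \<inter> L = {}"
    and "invertible (Y_LL Y)"
    and "S \<in> solvability_boundary Y"
    and "power_flow_solution Y S V I"
  shows "\<exists>h \<in> G \<union> L. norm (V $ h) \<le> (\<Sum>i\<in>UNIV. norm (Z_mat Y $ h $ i * I $ i))"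
proof (rule ccontr)
  let ?F = "\<lambda>I. \<chi> h. cnj (I $ h) * (E_vec Y - Z_mat Y *v I) $ h"
  assume "\<not> ?thesis"
  then have dominant: "(\<Sum>i\<in>UNIV. norm (Z_mat Y $ h $ i * I $ i)) < norm (V $ h)" for h
    using assms(1) by (auto simp: not_le)
  have V: "V = E_vec Y - Z_mat Y *v I" and S: "S = ?F I"
    using assms(5) by (auto simp: power_flow_solution_def vec_eq_iff)
  \<comment> \<open>The currents determine the voltages, so the solvable injections are parametrized
    by \<open>I'\<close> alone.\<close>
  have "power_flow_solution Y S' V' I' \<longleftrightarrow> V' = E_vec Y - Z_mat Y *v I' \<and> S' = ?F I'" for S' V' I'
    by (auto simp only: power_flow_solution_def vec_eq_iff[of S'] vec_lambda_beta)
  then have "{S. \<exists>V I. power_flow_solution Y S V I} = range ?F"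
    by (simp only: image_def) blast
  then have "S \<notin> interior (range ?F)"
    using assms(4) by (simp add: solvability_boundary_def frontier_def)
  then show False
    using power_flow_interior[OF dominant[unfolded V]] S by simp
qed

end
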